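(* If $r$ is a balanced rotor type having a balanced run decomposition of type $(b_1,b_2,\dots)$, then at least one of the following holds: (i) one of $b(UU(r))$ and $b(DD(r))$ is strictly larger than $b(r)$; (ii) there is a uniform run decomposition of $r$ of type $(b_1,b_2,\dots)$.
   Context: A two-state rotor type is an infinite periodic sequence $r=(r^{(1)},r^{(2)},\dots)$ over $\{1,2\}$ with fundamental period $|r|$ (convention $r^{(1)}=1$); it is balanced if $1$ and $2$ occur equally often in a period. A run is a contiguous block of consecutive positions; it is balanced if it contains equally many $1$'s and $2$'s and uniform if all its terms are equal. A balanced run decomposition (BRD) of a balanced $r$ is a partition of the period of $r$ into contiguous balanced runs; its type is the infinite periodic sequence $(b_1,b_2,\dots)$ where $2b_i$ is the length of the $i$-th run, $i$ taken modulo the number of runs. A uniform run decomposition (URD) of $r$ is a partition of the period of $r$ into contiguous uniform runs; its type is the infinite periodic sequence $(u_1,u_2,\dots)$ where $u_i$ is the length of the $i$-th run, $i$ taken modulo the number of runs. The balance coefficient $b(r)$ is the maximal number of runs in a BRD of $r$, divided by $|r|$. Rotor-router dynamics: at each non-target vertex $v$ there is a periodic sequence $e_v^{(1)},e_v^{(2)},\dots$ of out-edges; a particle starts at the source, on its $j$-th visit to $v$ leaves along $e_v^{(j)}$, and whenever it reaches a target it is returned to the source; the hitting sequence is the (periodic) sequence of targets reached. The compressor for $r$ has non-target vertices $1$ (source), $2,3$ and targets $4,5$. On the $j$-th departure: from vertex $1$ the particle goes to vertex $2$ if $r^{(j)}=1$ and to vertex $3$ if $r^{(j)}=2$; from vertex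 $2$, in variant $U$ it goes to vertex $1$ if $r^{(j)}=1$ and to target $4$ if $r^{(j)}=2$, in variant $D$ to target $4$ if $r^{(j)}=1$ and to vertex $1$ if $r^{(j)}=2$; from vertex $3$ likewise with target $5$. $UU(r)$ (resp. $DD(r)$) is the hitting sequence with variant $U$ (resp. $D$) at both vertices $2$ and $3$, viewed as a two-state rotor type ($4$ written as $1$, $5$ as $2$); these are balanced.
   Formalization: The balanced run decomposition is additionally required to have the maximal number of runs, i.e. to realise b(r); for an arbitrary one the claim fails: r = 122112 has b(r) = 1/2, the largest possible, and a one-run BRD of type (3,3,…), but no uniform run decomposition of that type. *)

theory Defs
  imports Complex_Main "HOL-Library.Infinite_Set"
begin

text \<open>Sequences are indexed from 0: \<open>r j\<close> stands for \<open>r\<^sup>(\<^sup>j\<^sup>+\<^sup>1\<^sup>)\<close>.\<close>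

definition is_period :: "(nat \<Rightarrow> 'a) \<Rightarrow> nat \<Rightarrow> bool" where
  "is_period r p \<longleftrightarrow> p > 0 \<and> (\<forall>n. r (n + p) = r n)"

definition fund_period :: "(nat \<Rightarrow> 'a) \<Rightarrow> nat" where
  "fund_period r = (LEAST p. is_period r p)"

text \<open>The normalisation \<open>r 0 = 1\<close> is not part of this predicate, because a hitting sequence
  read as a rotor type may start with 2; theorems that use the convention assume it.\<close>

definition rotor_type :: "(nat \<Rightarrow> nat) \<Rightarrow> bool" where
  "rotor_type r \<longleftrightarrow> range r \<subseteq> {1, 2} \<and> (\<exists>p. is_period r p)"

text \<open>The run starting at position \<open>i\<close> with length \<open>l\<close> occupies the positions \<open>{i..<i+l}\<close>.\<close>

definition balanced_run :: "(nat \<Rightarrow> nat) \<Rightarrow> nat \<Rightarrow> nat \<Rightarrow> bool" where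
  "balanced_run r i l \<longleftrightarrow> card {k \<in> {i..<i+l}. r k = 1} = card {k \<in> {i..<i+l}. r k = 2}"

definition uniform_run :: "(nat \<Rightarrow> nat) \<Rightarrow> nat \<Rightarrow> nat \<Rightarrow> bool" where
  "uniform_run r i l \<longleftrightarrow> (\<forall>k \<in> {i..<i+l}. \<forall>k' \<in> {i..<i+l}. r k = r k')"

definition balanced :: "(nat \<Rightarrow> nat) \<Rightarrow> bool" where
  "balanced r \<longleftrightarrow> balanced_run r 0 (fund_period r)"

text \<open>A partition of \<open>{0..<fund_period r}\<close> into contiguous nonempty runs is given by the list
  of the successive run lengths; run \<open>i\<close> starts at \<open>sum_list (take i ls)\<close>.\<close>

definition run_decomposition ::
    "((nat \<Rightarrow> nat) \<Rightarrow> nat \<Rightarrow> nat \<Rightarrow> bool) \<Rightarrow> (nat \<Rightarrow> nat) \<Rightarrow> nat list \<Rightarrow> bool" where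
  "run_decomposition P r ls \<longleftrightarrow>
     (\<forall>l \<in> set ls. l > 0) \<and> sum_list ls = fund_period r \<and>
     (\<forall>i < length ls. P r (sum_list (take i ls)) (ls ! i))"

abbreviation is_BRD :: "(nat \<Rightarrow> nat) \<Rightarrow> nat list \<Rightarrow> bool" where
  "is_BRD \<equiv> run_decomposition balanced_run"

abbreviation is_URD :: "(nat \<Rightarrow> nat) \<Rightarrow> nat list \<Rightarrow> bool" where
  "is_URD \<equiv> run_decomposition uniform_run"

definition BRD_of_type :: "(nat \<Rightarrow> nat) \<Rightarrow> nat list \<Rightarrow> (nat \<Rightarrow> nat) \<Rightarrow> bool" where
  "BRD_of_type r ls b \<longleftrightarrow> is_BRD r ls \<and> (\<forall>i. 2 * b i = ls ! (i mod length ls))"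

definition URD_of_type :: "(nat \<Rightarrow> nat) \<Rightarrow> nat list \<Rightarrow> (nat \<Rightarrow> nat) \<Rightarrow> bool" where
  "URD_of_type r ls u \<longleftrightarrow> is_URD r ls \<and> (\<forall>i. u i = ls ! (i mod length ls))"

text \<open>Only meaningful for balanced rotor types, where the set below is nonempty (take the
  whole period as the only run) and finite.\<close>

definition max_BRD_runs :: "(nat \<Rightarrow> nat) \<Rightarrow> nat" where
  "max_BRD_runs r = Max {length ls |ls. is_BRD r ls}"

definition balance_coeff :: "(nat \<Rightarrow> nat) \<Rightarrow> real" where
  "balance_coeff r = real (max_BRD_runs r) / real (fund_period r)"

text \<open>Rotor-router dynamics on a network without parallel edges, so that an out-edge is given
  by its head: \<open>e v j\<close> is the vertex to which the particle moves at its \<open>(j+1)\<close>-st departure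
  from \<open>v\<close>. A state is the current vertex together with the number of departures so far from
  each vertex; from a target in \<open>T\<close> the particle is returned to the source \<open>s\<close>.\<close>

definition rotor_step ::
    "'v \<Rightarrow> 'v set \<Rightarrow> ('v \<Rightarrow> nat \<Rightarrow> 'v) \<Rightarrow> 'v \<times> ('v \<Rightarrow> nat) \<Rightarrow> 'v \<times> ('v \<Rightarrow> nat)" where
  "rotor_step s T e = (\<lambda>(v, c). if v \<in> T then (s, c) else (e v (c v), c(v := c v + 1)))"

definition position :: "'v \<Rightarrow> 'v set \<Rightarrow> ('v \<Rightarrow> nat \<Rightarrow> 'v) \<Rightarrow> nat \<Rightarrow> 'v" where
  "position s T e n = fst ((rotor_step s T e ^^ n) (s, \<lambda>_. 0))"

text \<open>Only meaningful if targets are reached infinitely often.\<close>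

definition hitting_sequence :: "'v \<Rightarrow> 'v set \<Rightarrow> ('v \<Rightarrow> nat \<Rightarrow> 'v) \<Rightarrow> nat \<Rightarrow> 'v" where
  "hitting_sequence s T e j = position s T e (enumerate {n. position s T e n \<in> T} j)"

datatype variant = VarU | VarD

fun exit_vertex :: "variant \<Rightarrow> nat \<Rightarrow> nat \<Rightarrow> nat" where
  "exit_vertex VarU t x = (if x = 1 then 1 else t)"
| "exit_vertex VarD t x = (if x = 1 then t else 1)"

definition compressor :: "variant \<Rightarrow> variant \<Rightarrow> (nat \<Rightarrow> nat) \<Rightarrow> nat \<Rightarrow> nat \<Rightarrow> nat" where
  "compressor X Y r v j =
     (if v = 1 then (if r j = 1 then 2 else 3)
      else if v = 2 then exit_vertex X 4 (r j)
      else exit_vertex Y 5 (r j))"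

definition compressed :: "variant \<Rightarrow> variant \<Rightarrow> (nat \<Rightarrow> nat) \<Rightarrow> nat \<Rightarrow> nat" where
  "compressed X Y r j =
     (if hitting_sequence 1 {4, 5} (compressor X Y r) j = 4 then 1 else 2)"

definition UU :: "(nat \<Rightarrow> nat) \<Rightarrow> nat \<Rightarrow> nat" where
  "UU r = compressed VarU VarU r"

definition DD :: "(nat \<Rightarrow> nat) \<Rightarrow> nat \<Rightarrow> nat" where
  "DD r = compressed VarD VarD r"

end

theory Submission
  imports Defs
begin

text \<open>The particle's departure number \<open>k\<close> from the source produces a hit, on the target
  labelled \<open>r k\<close>, iff the term of \<open>r\<close> at the rank of \<open>k\<close> among the positions carrying the letter
  \<open>r k\<close> is 2 (for \<open>UU\<close>) or 1 (for \<open>DD\<close>). Hence every balanced prefix of \<open>r\<close>, of length \<open>2 m\<close> say,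
  yields a balanced prefix of \<open>UU r\<close> of length twice the number of 2's among the first \<open>m\<close> terms,
  and one of \<open>DD r\<close> of length twice the number of 1's there. As \<open>m\<close> runs through the half-lengths
  of balanced prefixes in two periods of \<open>r\<close>, a step from one \<open>m\<close> to the next gives a new
  balanced prefix of \<open>UU r\<close> if the block between them contains a 2, and of \<open>DD r\<close> if it contains
  a 1. If neither output has more balanced prefixes per period than \<open>r\<close>, no block contains both
  letters, and the blocks form the required uniform run decomposition.\<close>

section \<open>Counting letters in prefixes\<close>

text \<open>Polymorphic in the letter, so that the same periodicity lemmas also serve to count the
  places where a predicate such as \<open>hit\<close> or \<open>balanced_prefix s\<close> is
  true.\<close>

definition cnt :: "(nat \<Rightarrow> 'a) \<Rightarrow> 'a \<Rightarrow> nat \<Rightarrow> nat" where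
  "cnt s x k = card {i \<in> {..<k}. s i = x}"

lemma cnt_0 [simp]: "cnt s x 0 = 0"
  by (simp add: cnt_def)

lemma cnt_Suc: "cnt s x (Suc k) = cnt s x k + (if s k = x then 1 else 0)"
proof -
  have "{i \<in> {..<Suc k}. s i = x} =
      (if s k = x then insert k {i \<in> {..<k}. s i = x} else {i \<in> {..<k}. s i = x})"
    by (auto simp: less_Suc_eq)
  then show ?thesis
    by (simp add: cnt_def)
qed

lemma cnt_add: "cnt s x (i + l) = cnt s x i + card {k \<in> {i..<i + l}. s k = x}"
proof -
  have "{k \<in> {..<i + l}. s k = x} = {k \<in> {..<i}. s k = x} \<union> {k \<in> {i..<i + l}. s k = x}"
    by auto
  moreover have "{k \<in> {..<i}. s k = x} \<inter> {k \<in> {i..<i + l}. s k = x} = {}"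
    by auto
  ultimately show ?thesis
    by (simp only: cnt_def) (rule card_Un_disjoint; force)
qed

lemma cnt_mono: "i \<le> j \<Longrightarrow> cnt s x i \<le> cnt s x j"
  using cnt_add[of s x i "j - i"] by simp

lemma cnt_strict:
  assumes "i \<le> k" "k < j" "s k = x"
  shows "cnt s x i < cnt s x j"
  using cnt_mono[of i k s x] cnt_mono[of "Suc k" j s x] assms by (simp add: cnt_Suc)

lemma cnt_total:
  assumes "range r \<subseteq> {1, 2::nat}"
  shows "cnt r 1 k + cnt r 2 k = k"
proof (induction k)
  case (Suc k)
  have "r k = 1 \<or> r k = 2"
    using assms by auto
  then show ?case
    using Suc by (auto simp: cnt_Suc)
qed simp

lemma balanced_run_iff_cnt:
  "balanced_run r i l \<longleftrightarrow> cnt r 1 (i + l) + cnt r 2 i = cnt r 2 (i + l) + cnt r 1 i"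
  by (auto simp: balanced_run_def cnt_add)

lemma is_period_mult:
  assumes "is_period s p"
  shows "s (n + q * p) = s n"
proof (induction q)
  case (Suc q)
  have "s (n + Suc q * p) = s ((n + q * p) + p)"
    by (simp add: algebra_simps)
  then show ?case
    using assms Suc by (simp only: is_period_def)
qed simp

lemma cnt_add_period:
  assumes "is_period s p"
  shows "cnt s x (k + p) = cnt s x k + cnt s x p"
  by (induction k) (use assms in \<open>auto simp: cnt_Suc is_period_def\<close>)

lemma cnt_mult_period:
  assumes "is_period s p"
  shows "cnt s x (q * p) = q * cnt s x p"
proof (induction q)
  case (Suc q)
  then show ?case
    using cnt_add_period[OF assms, of x "q * p"] by (simp add: add.commute)
qed simp

lemma is_period_fund_period:
  assumes "is_period s p"
  shows "is_period s (fund_period s)"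
  unfolding fund_period_def using assms by (rule LeastI)

lemma fund_period_dvd:
  assumes "is_period s N"
  shows "fund_period s dvd N"
proof (rule ccontr)
  let ?p = "fund_period s"
  assume "\<not> ?p dvd N"
  then have pos: "N mod ?p > 0"
    by (simp add: mod_greater_zero_iff_not_dvd)
  have p: "is_period s ?p"
    by (rule is_period_fund_period[OF assms])
  have "s (n + N mod ?p) = s n" for n
  proof -
    have "s (n + N mod ?p) = s (n + N mod ?p + N div ?p * ?p)"
      by (rule is_period_mult[OF p, symmetric])
    also have "n + N mod ?p + N div ?p * ?p = n + N"
      by simp
    also have "s \<dots> = s n"
      using assms by (simp add: is_period_def)
    finally show ?thesis .
  qed
  with pos have "is_period s (N mod ?p)"
    by (simp add: is_period_def)
  then have "?p \<le> N mod ?p"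
    unfolding fund_period_def by (rule Least_le)
  moreover have "N mod ?p < ?p"
    using p by (simp add: is_period_def)
  ultimately show False
    by simp
qed

section \<open>Balanced prefixes and the balance coefficient\<close>

text \<open>The possible cut points of a BRD: every run of a BRD starts at such a position, and a
  block between two of them is balanced.\<close>

definition balanced_prefix :: "(nat \<Rightarrow> nat) \<Rightarrow> nat \<Rightarrow> bool" where
  "balanced_prefix s k \<longleftrightarrow> cnt s 1 k = cnt s 2 k"

text \<open>Cutting at every balanced prefix works; the induction splits off the last run, which
  begins at the largest balanced prefix shorter than \<open>n\<close>.\<close>

lemma ex_decomposition_at_balanced_prefixes:
  assumes "balanced_prefix s n"
  shows "\<exists>ls. (\<forall>l \<in> set ls. l > 0) \<and> sum_list ls = n \<and>
     (\<forall>i < length ls. balanced_run s (sum_list (take i ls)) (ls ! i)) \<and>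
     length ls = cnt (balanced_prefix s) True n"
  using assms
proof (induction n rule: less_induct)
  case (less n)
  show ?case
  proof (cases "n = 0")
    case True
    then show ?thesis by simp
  next
    case False
    define Q where "Q = {k \<in> {..<n}. balanced_prefix s k}"
    define q where "q = Max Q"
    have fin: "finite Q" and "0 \<in> Q"
      using False by (auto simp: Q_def balanced_prefix_def)
    then have "q \<in> Q" and max: "k \<le> q" if "k \<in> Q" for k
      using that by (auto simp: q_def intro: Max_in)
    then have q: "q < n" "balanced_prefix s q"
      using \<open>0 \<in> Q\<close> by (auto simp: Q_def)
    obtain ls where ls: "\<forall>l \<in> set ls. l > 0" "sum_list ls = q"
      "\<forall>i < length ls. balanced_run s (sum_list (take i ls)) (ls ! i)"
      "length ls = cnt (balanced_prefix s) True q"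
      using less.IH[OF q] by blast
    have "Q = insert q {k \<in> {..<q}. balanced_prefix s k}"
      using max q by (force simp: Q_def)
    then have "cnt (balanced_prefix s) True n = Suc (cnt (balanced_prefix s) True q)"
      by (simp add: cnt_def Q_def)
    moreover have "balanced_run s q (n - q)"
      using q less.prems by (simp add: balanced_run_iff_cnt balanced_prefix_def)
    ultimately show ?thesis
      using ls q by (intro exI[of _ "ls @ [n - q]"]) (auto simp: nth_append less_Suc_eq)
  qed
qed

text \<open>Allowing any period \<open>N\<close> avoids determining the fundamental period of an
  output: balanced prefixes recur with the fundamental period, so their number and \<open>N\<close>
  scale by the same factor.\<close>

lemma balance_coeff_ge:
  assumes per: "is_period s N" and bal: "balanced_prefix s N"
  shows "real (cnt (balanced_prefix s) True N) / real N \<le> balance_coeff s"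
proof -
  let ?p = "fund_period s"
  have p: "is_period s ?p"
    by (rule is_period_fund_period[OF per])
  obtain q where q: "N = q * ?p"
    using fund_period_dvd[OF per] by (auto simp: dvd_def mult.commute)
  have pos: "q > 0" "?p > 0"
    using per q by (auto simp: is_period_def intro: gr0I)
  have balp: "balanced_prefix s ?p"
    using bal pos cnt_mult_period[OF p, of _ q] by (simp add: balanced_prefix_def q)
  have "is_period (balanced_prefix s) ?p"
    unfolding is_period_def
    using balp pos cnt_add_period[OF p] by (simp add: balanced_prefix_def)
  then have zeros: "cnt (balanced_prefix s) True N = q * cnt (balanced_prefix s) True ?p"
    unfolding q by (rule cnt_mult_period)
  \<comment> \<open>Runs are nonempty, so their number is bounded; the set under \<open>Max\<close>
    is therefore finite.\<close>
  have len: "length ls \<le> ?p" if "is_BRD s ls" for ls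
  proof -
    have "length ls = (\<Sum>l\<leftarrow>ls. 1)"
      by (simp add: sum_list_triv)
    also have "\<dots> \<le> (\<Sum>l\<leftarrow>ls. l)"
      using that by (intro sum_list_mono) (auto simp: run_decomposition_def Suc_le_eq)
    finally show ?thesis
      using that by (simp add: run_decomposition_def)
  qed
  have "finite {length ls |ls. is_BRD s ls}"
    by (rule finite_subset[of _ "{..?p}"]) (auto dest: len)
  moreover have "cnt (balanced_prefix s) True ?p \<in> {length ls |ls. is_BRD s ls}"
    using ex_decomposition_at_balanced_prefixes[OF balp]
    by (auto simp: run_decomposition_def) metis
  ultimately have "cnt (balanced_prefix s) True ?p \<le> max_BRD_runs s"
    unfolding max_BRD_runs_def by (rule Max_ge)
  then show ?thesis
    using pos unfolding balance_coeff_def zeros by (simp add: q divide_right_mono)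
qed

section \<open>The hitting sequence of the compressor\<close>

text \<open>Turns the number of earlier target visits into an index of the hitting sequence.\<close>

lemma enumerate_card_less:
  fixes S :: "nat set"
  assumes "infinite S" "n \<in> S"
  shows "enumerate S (card {m. m < n \<and> m \<in> S}) = n"
proof -
  obtain j where j: "enumerate S j = n"
    using enumerate_Ex[of S n] assms by auto
  have "{m. m < n \<and> m \<in> S} = enumerate S ` {..<j}"
  proof (intro set_eqI iffI)
    fix m
    assume m: "m \<in> {m. m < n \<and> m \<in> S}"
    then obtain i where "enumerate S i = m"
      using enumerate_Ex[of S m] assms by auto
    with m j assms show "m \<in> enumerate S ` {..<j}"
      by (auto simp: enumerate_mono_iff)
  qed (use j assms in \<open>auto simp: enumerate_in_set\<close>)
  then have "card {m. m < n \<and> m \<in> S} = j"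
    by (simp add: card_image[OF inj_on_subset[OF inj_enumerate[OF assms(1)]]])
  with j show ?thesis by simp
qed

fun exit_letter :: "variant \<Rightarrow> nat" where
  "exit_letter VarU = 2"
| "exit_letter VarD = 1"

locale letter_compressor =
  fixes r :: "nat \<Rightarrow> nat" and X :: variant
  assumes range: "range r \<subseteq> {1, 2}"
begin

definition hit :: "nat \<Rightarrow> bool" where
  "hit k \<longleftrightarrow> r (cnt r (r k) k) = exit_letter X"

text \<open>The number of hits made by the first \<open>k\<close> departures from the source, hence
  the index of the next output term.\<close>

definition output_length :: "nat \<Rightarrow> nat" where
  "output_length = cnt hit True"

text \<open>A departure from the source takes two moves to come back to it, and three if it leads to a
  hit: the return from the target is a move of its own.\<close>

definition departure_time :: "nat \<Rightarrow> nat" where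
  "departure_time k = 2 * k + output_length k"

abbreviation "step \<equiv> rotor_step (1::nat) {4, 5} (compressor X X r)"
abbreviation "pos \<equiv> position (1::nat) {4, 5} (compressor X X r)"

text \<open>The departure counts in the state just before departure \<open>k\<close> from the
  source. The value 0 elsewhere matches the initial state; targets never increase their
  count.\<close>

definition visits :: "nat \<Rightarrow> nat \<Rightarrow> nat" where
  "visits k v = (if v = 1 then k else if v = 2 then cnt r 1 k else if v = 3 then cnt r 2 k else 0)"

lemma letter: "r k = 1 \<or> r k = 2"
  using range by auto

lemma departure_time_Suc:
  "departure_time (Suc k) = departure_time k + (if hit k then 3 else 2)"
  by (simp add: departure_time_def output_length_def cnt_Suc)

lemma step_twice:
  "step (step (1, visits k)) =
    (if hit k then (if r k = 1 then 4 else 5) else 1, visits (Suc k))"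
  using letter[of k] letter[of "cnt r 1 k"] letter[of "cnt r 2 k"]
  unfolding hit_def visits_def
  by (cases X) (auto simp: rotor_step_def compressor_def cnt_Suc fun_eq_iff)

lemma state_at_departure: "(step ^^ departure_time k) (1, \<lambda>_. 0) = (1, visits k)"
proof (induction k)
  case 0
  show ?case
    by (simp add: departure_time_def output_length_def visits_def fun_eq_iff)
next
  case (Suc k)
  have "departure_time (Suc k) = (if hit k then 3 else 2) + departure_time k"
    by (simp add: departure_time_Suc)
  then have "(step ^^ departure_time (Suc k)) (1, \<lambda>_. 0) =
      (step ^^ (if hit k then 3 else 2)) (1, visits k)"
    by (simp only: funpow_add o_apply Suc)
  also have "\<dots> = (if hit k then step (step (step (1, visits k))) else step (step (1, visits k)))"
    by (simp add: numeral_2_eq_2 numeral_3_eq_3)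
  also have "\<dots> = (1, visits (Suc k))"
    by (simp only: step_twice) (simp add: rotor_step_def)
  finally show ?case .
qed

lemma pos_after_departure:
  "pos (departure_time k) = 1"
  "pos (Suc (departure_time k)) \<in> {2, 3}"
  "pos (Suc (Suc (departure_time k))) = (if hit k then (if r k = 1 then 4 else 5) else 1)"
proof -
  show "pos (departure_time k) = 1"
    by (simp only: position_def state_at_departure fst_conv)
  show "pos (Suc (departure_time k)) \<in> {2, 3}"
    by (simp only: position_def funpow.simps o_apply state_at_departure)
      (simp add: rotor_step_def compressor_def)
  show "pos (Suc (Suc (departure_time k))) = (if hit k then (if r k = 1 then 4 else 5) else 1)"
    by (simp only: position_def funpow.simps o_apply state_at_departure step_twice fst_conv)
qed

abbreviation "at_target \<equiv> (\<lambda>n. pos n \<in> {4, 5})"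

lemma hits_before_departure: "cnt at_target True (departure_time k) = output_length k"
proof (induction k)
  case 0
  show ?case
    by (simp add: departure_time_def output_length_def)
next
  case (Suc k)
  have not_yet: "\<not> at_target (departure_time k)" "\<not> at_target (Suc (departure_time k))"
    using pos_after_departure(1,2)[of k] by auto
  have target: "at_target (Suc (Suc (departure_time k))) \<longleftrightarrow> hit k"
    using pos_after_departure(3)[of k] by auto
  show ?case
  proof (cases "hit k")
    case True
    then have "departure_time (Suc k) = Suc (Suc (Suc (departure_time k)))"
      by (simp add: departure_time_Suc)
    then show ?thesis
      using True not_yet target Suc by (simp only: cnt_Suc output_length_def if_True) simp
  next
    case False
    then have "departure_time (Suc k) = Suc (Suc (departure_time k))"
      by (simp add: departure_time_Suc)
    then show ?thesis
      using False not_yet Suc by (simp only: cnt_Suc output_length_def) simp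
  qed
qed

text \<open>The positions carrying \<open>x\<close> have the consecutive ranks 0, 1, 2 and so on, so
  the hits among them correspond to the exit letters in a prefix of \<open>r\<close>.\<close>

lemma cnt_hits_letter:
  "card {i \<in> {..<k}. hit i \<and> r i = x} = cnt r (exit_letter X) (cnt r x k)"
proof (induction k)
  case (Suc k)
  have "{i \<in> {..<Suc k}. hit i \<and> r i = x} =
      (if hit k \<and> r k = x then insert k {i \<in> {..<k}. hit i \<and> r i = x}
       else {i \<in> {..<k}. hit i \<and> r i = x})"
    by (auto simp: less_Suc_eq)
  then show ?case
    using Suc by (auto simp: cnt_Suc hit_def)
qed simp

lemma output_length_eq:
  "output_length k = cnt r (exit_letter X) (cnt r 1 k) + cnt r (exit_letter X) (cnt r 2 k)"
proof -
  have "{i \<in> {..<k}. hit i = True} =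
      {i \<in> {..<k}. hit i \<and> r i = 1} \<union> {i \<in> {..<k}. hit i \<and> r i = 2}"
    using letter by auto
  then have "output_length k =
      card {i \<in> {..<k}. hit i \<and> r i = 1} + card {i \<in> {..<k}. hit i \<and> r i = 2}"
    unfolding output_length_def cnt_def by (simp add: card_Un_disjoint disjoint_iff)
  then show ?thesis
    by (simp only: cnt_hits_letter)
qed

end

section \<open>Period and balanced prefixes of the output for a balanced rotor type\<close>

locale balanced_compressor = letter_compressor +
  fixes N :: nat
  assumes period: "is_period r N" and balanced_period: "cnt r 1 N = cnt r 2 N"
begin

lemma N_pos: "N > 0"
  using period by (simp add: is_period_def)

lemma cnt_period: "2 * cnt r (exit_letter X) N = N"
  using cnt_total[OF range, of N] balanced_period by (cases X) auto

text \<open>A single period moves each rank by only half of \<open>N\<close>, which need not be a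
  period of \<open>r\<close>; two periods move it by \<open>N\<close>, so the hits repeat.\<close>

lemma cnt_two_periods: "cnt r 1 (k + 2 * N) = cnt r 1 k + N" "cnt r 2 (k + 2 * N) = cnt r 2 k + N"
proof -
  have "cnt r x (k + 2 * N) = cnt r x k + 2 * cnt r x N" for x
    using cnt_add_period[OF period, of x k] cnt_add_period[OF period, of x "k + N"]
    by (simp add: mult_2 add.assoc)
  then show "cnt r 1 (k + 2 * N) = cnt r 1 k + N" "cnt r 2 (k + 2 * N) = cnt r 2 k + N"
    using cnt_total[OF range, of N] balanced_period by simp_all
qed

lemma letter_two_periods: "r (k + 2 * N) = r k"
  using is_period_mult[OF period, of k 2] by simp

lemma hit_two_periods: "hit (k + 2 * N) = hit k"
proof -
  have "cnt r (r k) (k + 2 * N) = cnt r (r k) k + N"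
    using letter[of k] cnt_two_periods by auto
  then show ?thesis
    using period by (simp add: hit_def letter_two_periods is_period_def)
qed

lemma output_length_two_periods: "output_length (k + 2 * N) = output_length k + N"
  using cnt_period
  by (simp add: output_length_eq cnt_two_periods cnt_add_period[OF period] del: One_nat_def)

lemma output_length_unbounded: "\<exists>k. n < output_length k"
proof -
  have "output_length (q * (2 * N)) = q * N" for q
  proof (induction q)
    case 0
    show ?case by (simp add: output_length_def)
  next
    case (Suc q)
    then show ?case
      using output_length_two_periods[of "q * (2 * N)"] by (simp add: add.commute)
  qed
  then have "output_length (Suc n * (2 * N)) = Suc n * N" .
  moreover have "n < Suc n * N"
    using N_pos mult_le_mono2[of 1 N "Suc n"] by simp
  ultimately show ?thesis by metis
qed

text \<open>\<open>output_length\<close> is unbounded and grows by at most 1 per departure, so the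
  departure that first pushes it above \<open>n\<close> is a hit with index
  \<open>n\<close>.\<close>

lemma ex_hit_at_output: "\<exists>k. hit k \<and> output_length k = n"
proof -
  define K where "K = (LEAST k. n < output_length k)"
  have K: "n < output_length K"
    unfolding K_def using output_length_unbounded by (rule LeastI_ex)
  then obtain k where k: "K = Suc k"
    by (cases K) (auto simp: output_length_def)
  then have "\<not> n < output_length k"
    unfolding K_def by (metis lessI not_less_Least)
  with K k show ?thesis
    by (auto simp: output_length_def cnt_Suc split: if_splits)
qed

lemma infinite_hits: "infinite {n. at_target n}"
proof
  assume fin: "finite {n. at_target n}"
  obtain k where k: "card {n. at_target n} < output_length k"
    using output_length_unbounded by blast
  have "cnt at_target True (departure_time k) \<le> card {n. at_target n}"
    unfolding cnt_def by (rule card_mono[OF fin]) auto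
  with k show False
    by (simp only: hits_before_departure)
qed

abbreviation "out \<equiv> compressed X X r"

lemma output_at_hit:
  assumes "hit k"
  shows "out (output_length k) = r k"
proof -
  let ?n = "Suc (Suc (departure_time k))"
  have target: "at_target ?n"
    using pos_after_departure(3)[of k] assms by auto
  have "\<not> at_target (departure_time k)" "\<not> at_target (Suc (departure_time k))"
    using pos_after_departure(1,2)[of k] by auto
  then have "cnt at_target True ?n = output_length k"
    using hits_before_departure[of k] by (simp only: cnt_Suc) simp
  then have card: "card {m. m < ?n \<and> m \<in> {n. at_target n}} = output_length k"
    by (simp add: cnt_def)
  have "enumerate {n. at_target n} (output_length k) = ?n"
    using enumerate_card_less[OF infinite_hits, of ?n] target unfolding card by blast
  then have "hitting_sequence 1 {4, 5} (compressor X X r) (output_length k) = pos ?n"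
    by (simp add: hitting_sequence_def)
  also have "\<dots> = (if r k = 1 then 4 else 5)"
    using pos_after_departure(3)[of k] assms by simp
  finally show ?thesis
    using letter[of k] by (auto simp: compressed_def)
qed

text \<open>Every output term comes from a hit, and two periods of \<open>r\<close> later there is a
  hit with the same letter, exactly \<open>N\<close> output terms further on.\<close>

lemma is_period_out: "is_period out N"
proof -
  have "out (n + N) = out n" for n
  proof -
    obtain k where k: "hit k" "output_length k = n"
      using ex_hit_at_output by blast
    have "out (output_length (k + 2 * N)) = r (k + 2 * N)"
      using k by (intro output_at_hit) (simp add: hit_two_periods)
    then show ?thesis
      using k output_at_hit[OF k(1)] by (simp add: output_length_two_periods letter_two_periods)
  qed
  then show ?thesis
    using N_pos by (simp add: is_period_def)
qed

lemma cnt_out: "cnt out x (output_length k) = cnt r (exit_letter X) (cnt r x k)"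
proof (induction k)
  case 0
  show ?case by (simp add: output_length_def)
next
  case (Suc k)
  have "output_length (Suc k) = (if hit k then Suc (output_length k) else output_length k)"
    by (simp add: output_length_def cnt_Suc)
  then show ?case
    using Suc output_at_hit[of k] by (auto simp: cnt_Suc hit_def)
qed

lemma balanced_prefix_out:
  assumes "balanced_prefix r (2 * m)"
  shows "balanced_prefix out (2 * cnt r (exit_letter X) m)"
proof -
  have "cnt r 1 (2 * m) = m" "cnt r 2 (2 * m) = m"
    using assms cnt_total[OF range, of "2 * m"] by (auto simp: balanced_prefix_def)
  then show ?thesis
    using cnt_out[of 1 "2 * m"] cnt_out[of 2 "2 * m"]
    by (simp add: balanced_prefix_def output_length_eq mult_2)
qed

lemma balance_coeff_out_ge:
  fixes m :: "nat \<Rightarrow> nat"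
  assumes mono: "\<And>i j. i \<le> j \<Longrightarrow> m i \<le> m j"
    and bal: "\<And>j. j \<le> L \<Longrightarrow> balanced_prefix r (2 * m j)" and mL: "m L = N"
  shows "real (card {j \<in> {..<L}. \<exists>i \<in> {m j..<m (Suc j)}. r i = exit_letter X}) / real N
    \<le> balance_coeff out"
proof -
  let ?y = "exit_letter X"
  define J where "J = {j \<in> {..<L}. \<exists>i \<in> {m j..<m (Suc j)}. r i = ?y}"
  \<comment> \<open>The balanced output prefix coming from the cut at \<open>2 * m j\<close>. It
    grows strictly when block \<open>j\<close> contains an exit letter, so \<open>f\<close> is
    injective on \<open>J\<close>.\<close>
  define f where "f j = 2 * cnt r ?y (m j)" for j
  have strict: "f j < f j'" if "j \<in> J" "j < j'" for j j'
  proof -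
    have "cnt r ?y (m j) < cnt r ?y (m (Suc j))"
      using that(1) by (auto simp: J_def intro: cnt_strict)
    also have "\<dots> \<le> cnt r ?y (m j')"
      using that(2) by (intro cnt_mono mono) simp
    finally show ?thesis by (simp add: f_def)
  qed
  have "inj_on f J"
    by (rule linorder_inj_onI') (use strict in force)
  then have "card J = card (f ` J)"
    by (simp add: card_image)
  also have "\<dots> \<le> card {i \<in> {..<N}. balanced_prefix out i = True}"
  proof (rule card_mono)
    show "f ` J \<subseteq> {i \<in> {..<N}. balanced_prefix out i = True}"
    proof (intro subsetI, elim imageE)
      fix n j
      assume n: "n = f j" and j: "j \<in> J"
      \<comment> \<open>Since \<open>f L = N\<close>, strictness at \<open>j\<close> keeps the
        prefix within one period of the output.\<close>
      then have "f j < f L"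
        by (intro strict) (auto simp: J_def)
      then have "f j < N"
        by (simp add: f_def mL cnt_period)
      moreover have "balanced_prefix out (f j)"
        unfolding f_def using j by (intro balanced_prefix_out bal) (simp add: J_def)
      ultimately show "n \<in> {i \<in> {..<N}. balanced_prefix out i = True}"
        by (simp add: n)
    qed
  qed simp
  finally have "card J \<le> cnt (balanced_prefix out) True N"
    by (simp add: cnt_def)
  moreover have "balanced_prefix out N"
    using balanced_prefix_out[of "m L"] bal[of L] by (simp add: mL cnt_period)
  ultimately show ?thesis
    using balance_coeff_ge[OF is_period_out]
    by (simp add: J_def) (meson divide_right_mono of_nat_0_le_iff of_nat_mono order_trans)
qed

end

section \<open>Comparison of the two outputs\<close>

theorem theorem7p10:
  fixes r b :: "nat \<Rightarrow> nat" and bs :: "nat list"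
  assumes "rotor_type r" and "r 0 = 1" and "balanced r"
    and "BRD_of_type r bs b" and "length bs = max_BRD_runs r"
  shows "(balance_coeff (UU r) > balance_coeff r \<or> balance_coeff (DD r) > balance_coeff r)
    \<or> (\<exists>us. URD_of_type r us b)"
proof (rule disjCI)
  assume no_URD: "\<not> (\<exists>us. URD_of_type r us b)"
  show "balance_coeff (UU r) > balance_coeff r \<or> balance_coeff (DD r) > balance_coeff r"
  proof (rule ccontr)
    assume "\<not> (balance_coeff (UU r) > balance_coeff r \<or> balance_coeff (DD r) > balance_coeff r)"
    then have le: "balance_coeff (UU r) \<le> balance_coeff r" "balance_coeff (DD r) \<le> balance_coeff r"
      by auto
    define N Z where "N = fund_period r" and "Z = length bs"
    have range: "range r \<subseteq> {1, 2}" and per: "is_period r N"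
      using assms(1) is_period_fund_period by (auto simp: rotor_type_def N_def)
    have Npos: "N > 0"
      using per by (simp add: is_period_def)
    have balN: "cnt r 1 N = cnt r 2 N"
      using assms(3) balanced_run_iff_cnt[of r 0 N] by (simp add: balanced_def N_def)
    have bspos: "\<forall>l \<in> set bs. l > 0" and bssum: "sum_list bs = N"
      and bsbal: "\<And>i. i < Z \<Longrightarrow> balanced_run r (sum_list (take i bs)) (bs ! i)"
      and b: "\<And>i. 2 * b i = bs ! (i mod Z)"
      using assms(4) by (auto simp: BRD_of_type_def run_decomposition_def N_def Z_def)
    have Zpos: "Z > 0"
      using Npos bssum by (auto simp: Z_def)
    have bpos: "b i > 0" for i
    proof -
      have "bs ! (i mod Z) \<in> set bs"
        using Zpos by (simp add: Z_def)
      then show ?thesis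
        using bspos b[of i] by force
    qed
    \<comment> \<open>Half the cut positions of the BRD, continued periodically. As
      \<open>m Z\<close> is half of \<open>N\<close>, the BRD has to be run through twice before
      \<open>m\<close> reaches \<open>N\<close>.\<close>
    define m where "m j = (\<Sum>i<j. b i)" for j
    have m_Suc: "m (Suc j) = m j + b j" for j
      by (simp add: m_def)
    have mono: "m i \<le> m j" if "i \<le> j" for i j
      unfolding m_def using that by (intro sum_mono2) auto
    have m_take: "2 * m j = sum_list (take j bs)" if "j \<le> Z" for j
      using that
    proof (induction j)
      case (Suc j)
      then show ?case
        using b[of j] by (simp add: m_Suc take_Suc_conv_app_nth Z_def)
    qed (simp add: m_def)
    have mZ: "2 * m Z = N"
      using m_take[of Z] bssum by (simp add: Z_def)
    have m_shift: "m (Z + j) = m Z + m j" for j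
    proof (induction j)
      case (Suc j)
      have "2 * b (Z + j) = 2 * b j"
        by (simp only: b) simp
      then show ?case
        using Suc by (simp add: m_Suc)
    qed (simp add: m_def)
    have bal_first: "balanced_prefix r (2 * m j)" if "j \<le> Z" for j
      using that
    proof (induction j)
      case (Suc j)
      then show ?case
        using bsbal[of j] m_take[of j] b[of j]
        by (simp add: balanced_run_iff_cnt balanced_prefix_def m_Suc)
    qed (simp add: m_def balanced_prefix_def)
    have bal: "balanced_prefix r (2 * m j)" if "j \<le> 2 * Z" for j
    proof (cases "j \<le> Z")
      case False
      then obtain i where i: "j = Z + i"
        by (metis le_Suc_ex nat_le_linear)
      have "2 * m j = 2 * m i + N"
        using mZ by (simp add: i m_shift)
      then show ?thesis
        using bal_first[of i] that i balN
        by (simp add: balanced_prefix_def cnt_add_period[OF per])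
    qed (rule bal_first)
    have m2Z: "m (2 * Z) = N"
      using m_shift[of Z] mZ by (simp add: mult_2)
    define J where "J y = {j \<in> {..<2 * Z}. \<exists>i \<in> {m j..<m (Suc j)}. r i = y}" for y
    \<comment> \<open>Here the maximality of the number of runs in \<open>bs\<close> enters.\<close>
    have coeff: "balance_coeff r = real Z / real N"
      using assms(5) by (simp add: balance_coeff_def Z_def N_def)
    have card_J: "card (J (exit_letter X)) \<le> Z"
      if "balance_coeff (compressed X X r) \<le> balance_coeff r" for X
    proof -
      interpret balanced_compressor r X N
        by unfold_locales (fact range per balN)+
      have "real (card (J (exit_letter X))) / real N \<le> balance_coeff (compressed X X r)"
        unfolding J_def by (rule balance_coeff_out_ge) (use mono bal m2Z in auto)
      also have "\<dots> \<le> real Z / real N"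
        using that coeff by simp
      finally show ?thesis
        using Npos by (simp add: divide_le_cancel)
    qed
    have card2: "card (J 2) \<le> Z" and card1: "card (J 1) \<le> Z"
      using card_J[of VarU] card_J[of VarD] le by (simp_all add: UU_def DD_def)
    have fin: "finite (J y)" for y
      by (simp add: J_def)
    \<comment> \<open>Blocks are nonempty, so each contains a 1 or a 2. Two sets of size at most
      \<open>Z\<close> that cover \<open>2 * Z\<close> indices must be disjoint.\<close>
    have "J 1 \<union> J 2 = {..<2 * Z}"
    proof
      show "{..<2 * Z} \<subseteq> J 1 \<union> J 2"
      proof
        fix j
        assume "j \<in> {..<2 * Z}"
        moreover have "m j \<in> {m j..<m (Suc j)}"
          using bpos[of j] by (simp add: m_Suc)
        moreover have "r (m j) = 1 \<or> r (m j) = 2"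
          using range by auto
        ultimately show "j \<in> J 1 \<union> J 2"
          unfolding J_def by blast
      qed
    qed (auto simp: J_def)
    then have "card (J 1) + card (J 2) = 2 * Z + card (J 1 \<inter> J 2)"
      using card_Un_Int[OF fin fin, of 1 2] by simp
    with card1 card2 have "card (J 1 \<inter> J 2) = 0"
      by simp
    then have disj: "J 1 \<inter> J 2 = {}"
      using fin by simp
    have uniform: "uniform_run r (m j) (b j)" if "j < 2 * Z" for j
      unfolding uniform_run_def
    proof (intro ballI)
      fix k k'
      assume k: "k \<in> {m j..<m j + b j}" "k' \<in> {m j..<m j + b j}"
      have "j \<in> J (r k)" "j \<in> J (r k')"
        using k that by (auto simp: J_def m_Suc)
      moreover have "r k \<in> {1, 2}" "r k' \<in> {1, 2}"
        using range by auto
      ultimately show "r k = r k'"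
        using disj by auto
    qed
    \<comment> \<open>The half-lengths of the BRD listed twice: they sum to \<open>N\<close>, and
      since \<open>b\<close> repeats after \<open>Z\<close> terms the type is still
      \<open>b\<close>.\<close>
    define us where "us = map b [0..<2 * Z]"
    have take_us: "sum_list (take i us) = m i" if "i \<le> 2 * Z" for i
    proof -
      have "take i us = map b [0..<i]"
        using that by (simp add: us_def take_map)
      then show ?thesis
        by (simp add: m_def interv_sum_list_conv_sum_set_nat atLeast0LessThan)
    qed
    have "b i = us ! (i mod length us)" for i
    proof -
      have "i mod (2 * Z) < 2 * Z"
        using Zpos by simp
      moreover have "2 * b (i mod (2 * Z)) = 2 * b i"
        by (simp only: b) (simp add: mod_mod_cancel)
      ultimately show ?thesis
        by (simp add: us_def)
    qed
    moreover have "is_URD r us"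
      unfolding run_decomposition_def
    proof (intro conjI allI impI)
      show "\<forall>l \<in> set us. l > 0"
        using bpos by (auto simp: us_def)
      show "sum_list us = fund_period r"
        using take_us[of "2 * Z"] m2Z by (simp add: us_def N_def)
      show "uniform_run r (sum_list (take i us)) (us ! i)" if "i < length us" for i
        using that uniform[of i] take_us[of i] by (simp add: us_def)
    qed
    ultimately have "URD_of_type r us b"
      by (simp add: URD_of_type_def)
    with no_URD show False
      by blast
  qed
qed

end
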